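(* Let $\mathcal{H}$ be a Hilbert space over $\mathbb{K}\in\{\mathbb{R},\mathbb{C}\}$ of finite dimension $d$, let $(\Omega,\mu)$ be a measure space, and let $\{\tau_\alpha\}_{\alpha\in\Omega}$ be a normalized continuous Bessel family for $\mathcal{H}$. Then $$\frac{\mu(\Omega)^2}{d}\ \le\ FP(\{\tau_\alpha\}_{\alpha\in\Omega})\ \le\ \mu(\Omega)^2.$$ Further, if the diagonal $\Delta:=\{(\alpha,\alpha):\alpha\in\Omega\}$ is measurable in $\Omega\times\Omega$, then also $$(\mu\times\mu)(\Delta)\ \le\ FP(\{\tau_\alpha\}_{\alpha\in\Omega})\ \le\ \mu(\Omega)^2.$$
   Context: A collection $\{\tau_\alpha\}_{\alpha\in\Omega}$ in a finite-dimensional Hilbert space $\mathcal{H}$ over $\mathbb{K}$ is a continuous Bessel family for $\mathcal{H}$ if (i) for each $h\in\mathcal{H}$ the map $\Omega\ni\alpha\mapsto\langle h,\tau_\alpha\rangle\in\mathbb{K}$ is measurable, and (ii) there is $b>0$ with $\int_\Omega|\langle h,\tau_\alpha\rangle|^2\,d\mu(\alpha)\le b\|h\|^2$ for all $h\in\mathcal{H}$. It is normalized if $\|\tau_\alpha\|=1$ for all $\alpha\in\Omega$. $\mu\times\mu$ is the product measure on $\Omega\times\Omega$. The continuous frame potential of a normalized continuous Bessel family is $$FP(\{\tau_\alpha\}_{\alpha\in\Omega}):=\int_\Omega\int_\Omega|\langle\tau_\alpha,\tau_\beta\rangle|^2\,d\mu(\alpha)\,d\mu(\beta).$$ *)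

theory Defs
  imports "HOL-Analysis.Analysis"
begin

text \<open>
  The scalar field is a normed field identified, via an isometric field embedding into the
  complex numbers, with either the reals or the complex numbers. Its topology, and hence its
  Borel sigma-algebra, is the one of the norm.
\<close>

class real_or_complex = real_normed_field +
  fixes to_complex :: "'a \<Rightarrow> complex"
  assumes to_complex_add: "to_complex (x + y) = to_complex x + to_complex y"
    and to_complex_mult: "to_complex (x * y) = to_complex x * to_complex y"
    and to_complex_scaleR: "to_complex (r *\<^sub>R x) = r *\<^sub>R to_complex x"
    and to_complex_one: "to_complex 1 = 1"
    and norm_to_complex: "norm (to_complex x) = norm x"
    and range_to_complex: "range to_complex = \<real> \<or> range to_complex = UNIV"

instantiation real :: real_or_complex
begin

definition to_complex_real :: "real \<Rightarrow> complex" where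
  "to_complex_real = complex_of_real"

instance
  by standard (auto simp: to_complex_real_def Reals_def scaleR_conv_of_real)

end

instantiation complex :: real_or_complex
begin

definition to_complex_complex :: "complex \<Rightarrow> complex" where
  "to_complex_complex = (\<lambda>z. z)"

instance
  by standard (auto simp: to_complex_complex_def)

end

locale inner_product_space = vector_space scale
  for scale :: "'k::real_or_complex \<Rightarrow> 'v::ab_group_add \<Rightarrow> 'v" +
  fixes ip :: "'v \<Rightarrow> 'v \<Rightarrow> 'k"
  assumes ip_add_left: "ip (x + y) z = ip x z + ip y z"
    and ip_scale_left: "ip (scale c x) y = c * ip x y"
    and ip_conj_sym: "to_complex (ip y x) = cnj (to_complex (ip x y))"
    and ip_self_nonneg: "0 \<le> Re (to_complex (ip x x))"
    and ip_self_eq_0: "ip x x = 0 \<Longrightarrow> x = 0"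

definition ip_norm :: "('v \<Rightarrow> 'v \<Rightarrow> 'k::real_or_complex) \<Rightarrow> 'v \<Rightarrow> real" where
  "ip_norm ip x = sqrt (Re (to_complex (ip x x)))"

locale hilbert_space = inner_product_space scale ip
  for scale :: "'k::real_or_complex \<Rightarrow> 'v::ab_group_add \<Rightarrow> 'v"
    and ip :: "'v \<Rightarrow> 'v \<Rightarrow> 'k" +
  assumes complete: "Metric_space.mcomplete UNIV (\<lambda>x y. ip_norm ip (x - y))"

definition continuous_Bessel_family ::
  "('v \<Rightarrow> 'v \<Rightarrow> 'k::real_or_complex) \<Rightarrow> 'w measure \<Rightarrow> ('w \<Rightarrow> 'v) \<Rightarrow> bool" where
  "continuous_Bessel_family ip M \<tau> \<longleftrightarrow>
    (\<forall>h. (\<lambda>\<alpha>. ip h (\<tau> \<alpha>)) \<in> borel_measurable M) \<and>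
    (\<exists>b>0. \<forall>h. (\<integral>\<^sup>+\<alpha>. ennreal ((norm (ip h (\<tau> \<alpha>)))\<^sup>2) \<partial>M) \<le> ennreal (b * (ip_norm ip h)\<^sup>2))"

definition normalized_family ::
  "('v \<Rightarrow> 'v \<Rightarrow> 'k::real_or_complex) \<Rightarrow> 'w measure \<Rightarrow> ('w \<Rightarrow> 'v) \<Rightarrow> bool" where
  "normalized_family ip M \<tau> \<longleftrightarrow> (\<forall>\<alpha>\<in>space M. ip_norm ip (\<tau> \<alpha>) = 1)"

definition frame_potential ::
  "('v \<Rightarrow> 'v \<Rightarrow> 'k::real_or_complex) \<Rightarrow> 'w measure \<Rightarrow> ('w \<Rightarrow> 'v) \<Rightarrow> ennreal" where
  "frame_potential ip M \<tau> =
    (\<integral>\<^sup>+\<beta>. (\<integral>\<^sup>+\<alpha>. ennreal ((norm (ip (\<tau> \<alpha>) (\<tau> \<beta>)))\<^sup>2) \<partial>M) \<partial>M)"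

definition diagonal :: "'w measure \<Rightarrow> ('w \<times> 'w) set" where
  "diagonal M = {(\<alpha>, \<alpha>) | \<alpha>. \<alpha> \<in> space M}"

end

theory Submission
  imports Defs
begin

text \<open>
  Coordinates with respect to an orthonormal basis turn the lower bound into a statement about
  a Gram matrix. Parseval's identity \<open>parseval\<close> gives
  \<open>1 = (\<Sum>e. \<bar>\<langle>\<tau> \<alpha>, e\<rangle>\<bar>\<^sup>2)\<close> for every \<open>\<alpha>\<close>; integrating this and applying the Bessel bound to
  each of the finitely many basis vectors shows that \<open>\<mu>\<close> is a finite measure. All coordinate
  functions \<open>t\<^sub>i = \<langle>\<tau>, e\<^sub>i\<rangle>\<close> are bounded by 1, so that their products are integrable.

  Put \<open>G\<^sub>i\<^sub>j = \<integral> t\<^sub>i cnj(t\<^sub>j) d\<mu>\<close>. Expanding the square of the inner product separates the variables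
  \<open>\<alpha>\<close> and \<open>\<beta>\<close>, whence the frame potential is \<open>\<Sum>\<^sub>i\<^sub>j \<bar>G\<^sub>i\<^sub>j\<bar>\<^sup>2\<close>, while the trace of \<open>G\<close> is \<open>\<mu>(\<Omega>)\<close>. Dropping
  the off-diagonal entries and applying the Cauchy-Schwarz inequality to the trace yields
  \<open>\<mu>(\<Omega>)\<^sup>2 \<le> d FP\<close>; this is \<open>frame_potential_coordinates_ge\<close>.

  The remaining bounds are pointwise: the integrand is at most 1 by the Cauchy-Schwarz inequality
  and equals 1 on the diagonal, hence dominates its indicator function.
\<close>

section \<open>The embedding of the scalars\<close>

lemma to_complex_zero: "to_complex (0::'k::real_or_complex) = 0"
  using to_complex_add[of "0::'k" 0] by simp

lemma to_complex_diff: "to_complex (x - y :: 'k::real_or_complex) = to_complex x - to_complex y"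
  using to_complex_add[of "x - y" y] by simp

lemma to_complex_sum:
  "to_complex (\<Sum>i\<in>A. f i :: 'k::real_or_complex) = (\<Sum>i\<in>A. to_complex (f i))"
  by (induction A rule: infinite_finite_induct) (simp_all add: to_complex_zero to_complex_add)

lemma to_complex_inject: "to_complex (x::'k::real_or_complex) = to_complex y \<longleftrightarrow> x = y"
  by (metis norm_to_complex to_complex_diff norm_eq_zero right_minus_eq)

lemma to_complex_of_real: "to_complex (of_real r :: 'k::real_or_complex) = of_real r"
  using to_complex_scaleR[of r "1::'k"] by (simp add: of_real_def to_complex_one)

lemma measurable_cnj [measurable]: "cnj \<in> borel_measurable borel"
  by (intro borel_measurable_continuous_onI continuous_intros)

lemma measurable_to_complex [measurable]:
  "(to_complex :: 'k::real_or_complex \<Rightarrow> complex) \<in> borel_measurable borel"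
proof (rule borel_measurable_continuous_onI)
  have "bounded_linear (to_complex :: 'k \<Rightarrow> complex)"
    by (rule bounded_linear_intro[where K = 1])
       (simp_all add: to_complex_add to_complex_scaleR norm_to_complex)
  then show "continuous_on UNIV (to_complex :: 'k \<Rightarrow> complex)"
    by (rule linear_continuous_on)
qed

section \<open>Orthonormal expansions\<close>

context inner_product_space
begin

lemma ip_diff_left: "ip (x - y) z = ip x z - ip y z"
  using ip_add_left[of "x - y" y z] by simp

lemma ip_zero_left: "ip 0 z = 0"
  using ip_add_left[of 0 0 z] by simp

lemma ip_sum_left: "ip (\<Sum>i\<in>A. f i) z = (\<Sum>i\<in>A. ip (f i) z)"
  by (induction A rule: infinite_finite_induct) (simp_all add: ip_zero_left ip_add_left)

lemma ip_eq_0_commute: "ip x y = 0 \<longleftrightarrow> ip y x = 0"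
  by (metis ip_conj_sym to_complex_zero to_complex_inject complex_cnj_zero_iff)

lemma norm_ip_commute: "norm (ip x y) = norm (ip y x)"
  by (metis ip_conj_sym complex_mod_cnj norm_to_complex)

lemma to_complex_ip_self: "to_complex (ip x x) = of_real ((ip_norm ip x)\<^sup>2)"
proof -
  have "Im (to_complex (ip x x)) = 0"
    using arg_cong[OF ip_conj_sym[of x x], of Im] by simp
  then show ?thesis
    by (simp add: ip_norm_def ip_self_nonneg complex_eq_iff)
qed

lemma ip_self_of_unit:
  assumes "ip_norm ip x = 1"
  shows "ip x x = 1"
  using to_complex_ip_self[of x] assms
  by (metis of_real_1 one_power2 to_complex_inject to_complex_one)

lemma ip_mult_ip_swap: "to_complex (ip x y * ip y x) = of_real ((norm (ip x y))\<^sup>2)"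
  unfolding to_complex_mult norm_to_complex[of "ip x y", symmetric] complex_norm_square
  by (simp add: ip_conj_sym[of x y])

definition orthonormal :: "'v set \<Rightarrow> bool" where
  "orthonormal E \<longleftrightarrow> (\<forall>e\<in>E. \<forall>f\<in>E. ip e f = (if e = f then 1 else 0))"

definition proj :: "'v set \<Rightarrow> 'v \<Rightarrow> 'v" where
  "proj E x = (\<Sum>e\<in>E. scale (ip x e) e)"

lemma ip_combination_orthonormal:
  assumes "finite E" "orthonormal E" "f \<in> E"
  shows "ip (\<Sum>e\<in>E. scale (u e) e) f = u f"
proof -
  have "ip (\<Sum>e\<in>E. scale (u e) e) f = (\<Sum>e\<in>E. if e = f then u e else 0)"
    unfolding ip_sum_left using assms
    by (intro sum.cong) (auto simp: ip_scale_left orthonormal_def)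
  then show ?thesis using assms by simp
qed

lemma ip_residual_orthogonal:
  assumes "finite E" "orthonormal E" "f \<in> E"
  shows "ip (x - proj E x) f = 0"
  unfolding proj_def ip_diff_left ip_combination_orthonormal[OF assms] by simp

text \<open>
  The residual is orthogonal to the projection, so \<open>\<langle>r, r\<rangle> = \<langle>x, r\<rangle>\<close>, and \<open>\<langle>r, x\<rangle>\<close> is computed by
  linearity in the first argument alone. A singleton \<open>E\<close> gives the Cauchy-Schwarz inequality,
  and a basis gives Parseval's identity.
\<close>

lemma ip_norm_pythagoras:
  assumes "finite E" "orthonormal E"
  shows "(ip_norm ip x)\<^sup>2 = (ip_norm ip (x - proj E x))\<^sup>2 + (\<Sum>e\<in>E. (norm (ip x e))\<^sup>2)"
proof -
  let ?r = "x - proj E x"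
  have "ip (proj E x) ?r = 0"
    unfolding proj_def ip_sum_left ip_scale_left
  proof (intro sum.neutral ballI)
    fix e assume "e \<in> E"
    then have "ip e ?r = 0"
      using ip_residual_orthogonal[OF assms] ip_eq_0_commute by blast
    then show "ip x e * ip e (x - (\<Sum>e\<in>E. scale (ip x e) e)) = 0"
      by (simp add: proj_def)
  qed
  then have rr: "ip ?r ?r = ip x ?r"
    by (simp add: ip_diff_left)
  have "to_complex (ip ?r x) = of_real ((ip_norm ip x)\<^sup>2 - (\<Sum>e\<in>E. (norm (ip x e))\<^sup>2))"
    unfolding ip_diff_left proj_def ip_sum_left ip_scale_left to_complex_diff to_complex_sum
      ip_mult_ip_swap to_complex_ip_self by simp
  moreover have "to_complex (ip ?r ?r) = cnj (to_complex (ip ?r x))"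
    unfolding rr by (rule ip_conj_sym)
  ultimately have "to_complex (ip ?r ?r) = of_real ((ip_norm ip x)\<^sup>2 - (\<Sum>e\<in>E. (norm (ip x e))\<^sup>2))"
    by (simp only: complex_cnj_complex_of_real)
  then show ?thesis
    unfolding to_complex_ip_self of_real_eq_iff by simp
qed

lemma norm_ip_le_1:
  assumes "ip_norm ip x = 1" "ip_norm ip y = 1"
  shows "(norm (ip x y))\<^sup>2 \<le> 1"
proof -
  have "orthonormal {y}"
    using ip_self_of_unit[OF assms(2)] by (simp add: orthonormal_def)
  from ip_norm_pythagoras[OF _ this, of x] assms(1)
  have "1 = (ip_norm ip (x - proj {y} x))\<^sup>2 + (norm (ip x y))\<^sup>2"
    by simp
  then show ?thesis
    using zero_le_power2[of "ip_norm ip (x - proj {y} x)"] by linarith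
qed

lemma independent_orthonormal:
  assumes "orthonormal E"
  shows "independent E"
proof
  assume "dependent E"
  then obtain t u v where t: "finite t" "t \<subseteq> E" "(\<Sum>v\<in>t. scale (u v) v) = 0" "v \<in> t" "u v \<noteq> 0"
    unfolding dependent_explicit by blast
  have "orthonormal t"
    using assms t(2) unfolding orthonormal_def by (meson subsetD)
  from ip_combination_orthonormal[OF t(1) this t(4), of u] t(3,5) show False
    by (simp add: ip_zero_left)
qed

lemma ip_self_normalize:
  assumes "r \<noteq> 0"
  shows "\<exists>c. ip (scale c r) (scale c r) = 1"
proof
  define n where "n = ip_norm ip r"
  have "n \<noteq> 0"
    using assms ip_self_eq_0 to_complex_ip_self[of r] to_complex_inject[of "ip r r" 0]
    by (auto simp: n_def to_complex_zero)
  let ?c = "of_real (1 / n) :: 'k"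
  have "to_complex (ip (scale ?c r) (scale ?c r))
      = of_real (1/n) * cnj (of_real (1/n) * to_complex (ip r r))"
    by (simp only: ip_scale_left to_complex_mult ip_conj_sym[of r "scale ?c r"] to_complex_of_real)
  also have "\<dots> = of_real ((1/n) * ((1/n) * n\<^sup>2))"
    by (simp only: to_complex_ip_self n_def complex_cnj_mult complex_cnj_complex_of_real of_real_mult)
  also have "(1/n) * ((1/n) * n\<^sup>2) = 1"
    using \<open>n \<noteq> 0\<close> by (simp add: power2_eq_square)
  finally show "ip (scale ?c r) (scale ?c r) = 1"
    by (metis of_real_1 to_complex_inject to_complex_one)
qed

text \<open>
  Orthonormal sets are independent, so their cardinalities are bounded by the dimension and one of
  maximal cardinality exists. A nonzero residual could be normalized and added to it; hence every
  vector is its own projection. The two properties \<open>card E \<le> dim UNIV\<close> and \<open>proj E x = x\<close> express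
  what the estimates ask of a basis, without mentioning spans.
\<close>

lemma exists_orthonormal_basis:
  assumes "finite_dimensional_vector_space scale B"
  obtains E where "finite E" "card E \<le> dim UNIV" "orthonormal E" "\<And>x. proj E x = x"
proof -
  interpret fd: finite_dimensional_vector_space scale B by fact
  define P where "P n \<longleftrightarrow> (\<exists>E. finite E \<and> orthonormal E \<and> card E = n)" for n
  have bound: "card E \<le> dim UNIV" if "orthonormal E" for E
    using fd.independent_card_le_dim[of E UNIV] independent_orthonormal[OF that] by simp
  have "P 0"
    unfolding P_def by (intro exI[of _ "{}"]) (simp add: orthonormal_def)
  then obtain n where n: "P n" "\<And>m. P m \<Longrightarrow> m \<le> n"
    using GreatestI_nat[of P 0 "dim UNIV"] Greatest_le_nat[of P _ "dim UNIV"] bound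
    by (metis P_def)
  then obtain E where E: "finite E" "orthonormal E" "card E = n"
    unfolding P_def by blast
  have "proj E x = x" for x
  proof (rule ccontr)
    assume "proj E x \<noteq> x"
    then have "x - proj E x \<noteq> 0" by simp
    then obtain c where c: "ip (scale c (x - proj E x)) (scale c (x - proj E x)) = 1"
      using ip_self_normalize by blast
    define g where "g = scale c (x - proj E x)"
    have gE: "ip g f = 0" "ip f g = 0" if "f \<in> E" for f
      using ip_residual_orthogonal[OF E(1,2) that] ip_eq_0_commute[of f g]
      by (simp_all add: g_def ip_scale_left)
    have gg: "ip g g = 1" using c by (simp add: g_def)
    then have "g \<notin> E" using gE by fastforce
    moreover have "orthonormal (insert g E)"
      using E(2) gE gg by (auto simp: orthonormal_def)
    ultimately have "P (Suc n)"
      unfolding P_def using E by (intro exI[of _ "insert g E"]) simp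
    then show False using n(2) by fastforce
  qed
  then show ?thesis using that E bound by blast
qed

lemma parseval:
  assumes "finite E" "orthonormal E" "\<And>x. proj E x = x"
  shows "(\<Sum>e\<in>E. (norm (ip x e))\<^sup>2) = (ip_norm ip x)\<^sup>2"
  using ip_norm_pythagoras[OF assms(1,2), of x] assms(3)[of x]
  by (simp add: ip_norm_def ip_zero_left to_complex_zero)

lemma ip_expansion:
  assumes "proj E x = x"
  shows "to_complex (ip x y) = (\<Sum>e\<in>E. to_complex (ip x e) * cnj (to_complex (ip y e)))"
proof -
  have "ip x y = ip (proj E x) y" using assms by simp
  then show ?thesis
    by (simp add: proj_def ip_sum_left ip_scale_left to_complex_sum to_complex_mult
        ip_conj_sym[of _ y])
qed

end

section \<open>The frame potential in coordinates\<close>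

text \<open>
  The double integral equals the squared Hilbert-Schmidt norm of the Gram matrix of the coordinate
  functions. This is at least the sum of the squared diagonal entries, which by the
  Cauchy-Schwarz inequality is at least the squared trace divided by the size of the matrix. Writing
  \<open>card I\<close> as a factor and not as a divisor covers \<open>card I = 0\<close> uniformly.
\<close>

lemma (in finite_measure) frame_potential_coordinates_ge:
  fixes t :: "'i \<Rightarrow> 'a \<Rightarrow> complex"
  assumes fin: "finite I"
    and meas [measurable]: "\<And>i. i \<in> I \<Longrightarrow> t i \<in> borel_measurable M"
    and unit: "\<And>x. x \<in> space M \<Longrightarrow> (\<Sum>i\<in>I. (norm (t i x))\<^sup>2) = 1"
  shows "(emeasure M (space M))\<^sup>2 \<le> of_nat (card I) *
    (\<integral>\<^sup>+y. (\<integral>\<^sup>+x. ennreal ((norm (\<Sum>i\<in>I. t i x * cnj (t i y)))\<^sup>2) \<partial>M) \<partial>M)"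
proof -
  have t_le: "norm (t i x) \<le> 1" if "i \<in> I" "x \<in> space M" for i x
  proof -
    have "(norm (t i x))\<^sup>2 \<le> (\<Sum>i\<in>I. (norm (t i x))\<^sup>2)"
      using fin that by (intro member_le_sum) auto
    then show ?thesis using unit[OF that(2)] by (simp add: power_le_one_iff)
  qed
  have int: "integrable M (\<lambda>x. t i x * cnj (t j x))" if "i \<in> I" "j \<in> I" for i j
  proof (rule integrable_const_bound[where B = 1])
    show "AE x in M. norm (t i x * cnj (t j x)) \<le> 1"
      using t_le that by (intro AE_I2) (auto simp: norm_mult intro!: mult_le_one)
  qed (use that in measurable)
  define G where "G i j = (LINT x|M. t i x * cnj (t j x))" for i j
  have G_cnj: "(LINT x|M. cnj (t i x) * t j x) = cnj (G i j)" for i j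
    using Bochner_Integration.integral_cnj[of M "\<lambda>x. t i x * cnj (t j x)"] by (simp add: G_def)
  define k where "k x y = (norm (\<Sum>i\<in>I. t i x * cnj (t i y)))\<^sup>2" for x y
  have k: "complex_of_real (k x y) =
      (\<Sum>i\<in>I. \<Sum>j\<in>I. (t i x * cnj (t j x)) * (cnj (t i y) * t j y))" for x y
    unfolding k_def complex_norm_square cnj_sum sum_product
    by (simp add: mult_ac)
  have int_k: "integrable M (\<lambda>x. complex_of_real (k x y))" for y
    unfolding k by (intro Bochner_Integration.integrable_sum integrable_mult_left int)
  have inner: "complex_of_real (LINT x|M. k x y) = (\<Sum>i\<in>I. \<Sum>j\<in>I. G i j * (cnj (t i y) * t j y))" for y
  proof -
    have "complex_of_real (LINT x|M. k x y) = (LINT x|M. complex_of_real (k x y))"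
      by simp
    also have "\<dots> = (\<Sum>i\<in>I. \<Sum>j\<in>I. G i j * (cnj (t i y) * t j y))"
      unfolding k G_def
      by (simp add: Bochner_Integration.integral_sum Bochner_Integration.integrable_sum int)
    finally show ?thesis .
  qed
  have int': "integrable M (\<lambda>y. cnj (t i y) * t j y)" if "i \<in> I" "j \<in> I" for i j
    using int[OF that(2,1)] by (simp add: mult.commute)
  have int_F: "integrable M (\<lambda>y. complex_of_real (LINT x|M. k x y))"
    unfolding inner by (intro Bochner_Integration.integrable_sum integrable_mult_right int')
  have "complex_of_real (LINT y|M. LINT x|M. k x y) = (LINT y|M. complex_of_real (LINT x|M. k x y))"
    by simp
  also have "\<dots> = (\<Sum>i\<in>I. \<Sum>j\<in>I. G i j * cnj (G i j))"
    unfolding inner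
    by (simp add: Bochner_Integration.integral_sum Bochner_Integration.integrable_sum int' G_cnj)
  also have "\<dots> = complex_of_real (\<Sum>i\<in>I. \<Sum>j\<in>I. (norm (G i j))\<^sup>2)"
    by (simp only: of_real_sum complex_norm_square)
  finally have FP: "(LINT y|M. LINT x|M. k x y) = (\<Sum>i\<in>I. \<Sum>j\<in>I. (norm (G i j))\<^sup>2)"
    unfolding of_real_eq_iff .
  have nn: "(\<integral>\<^sup>+y. (\<integral>\<^sup>+x. ennreal (k x y) \<partial>M) \<partial>M) = ennreal (LINT y|M. LINT x|M. k x y)"
  proof -
    have k_nonneg: "0 \<le> k x y" for x y
      by (simp add: k_def)
    have "(\<integral>\<^sup>+x. ennreal (k x y) \<partial>M) = ennreal (LINT x|M. k x y)" for y
      using int_k[of y] k_nonneg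
      by (intro nn_integral_eq_integral) (simp_all add: complex_of_real_integrable_eq)
    moreover have "(\<integral>\<^sup>+y. ennreal (LINT x|M. k x y) \<partial>M) = ennreal (LINT y|M. LINT x|M. k x y)"
      using int_F k_nonneg
      by (intro nn_integral_eq_integral)
         (simp_all only: complex_of_real_integrable_eq Bochner_Integration.integral_nonneg AE_I2)
    ultimately show ?thesis by simp
  qed
  have trace: "complex_of_real (measure M (space M)) = (\<Sum>i\<in>I. G i i)"
  proof -
    have "(\<Sum>i\<in>I. G i i) = (LINT x|M. (\<Sum>i\<in>I. t i x * cnj (t i x)))"
      unfolding G_def by (simp add: Bochner_Integration.integral_sum int)
    also have "\<dots> = (LINT x|M. 1)"
    proof (rule Bochner_Integration.integral_cong[OF refl])
      fix x assume "x \<in> space M"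
      from arg_cong[OF unit[OF this], of complex_of_real]
      show "(\<Sum>i\<in>I. t i x * cnj (t i x)) = 1"
        by (simp only: of_real_sum complex_norm_square of_real_1)
    qed
    finally show ?thesis by (simp add: scaleR_conv_of_real)
  qed
  have "measure M (space M) \<le> (\<Sum>i\<in>I. norm (G i i))"
    using norm_sum[of "\<lambda>i. G i i" I] by (simp add: trace[symmetric])
  then have "(measure M (space M))\<^sup>2 \<le> (\<Sum>i\<in>I. norm (G i i))\<^sup>2"
    by (intro power_mono) auto
  also have "\<dots> \<le> real (card I) * (\<Sum>i\<in>I. (norm (G i i))\<^sup>2)"
    using sum_squared_le_sum_of_squares[of "\<lambda>i. norm (G i i)" I] by (simp add: mult.commute)
  also have "\<dots> \<le> real (card I) * (\<Sum>i\<in>I. \<Sum>j\<in>I. (norm (G i j))\<^sup>2)"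
    using fin by (intro mult_left_mono sum_mono member_le_sum) auto
  finally have "ennreal ((measure M (space M))\<^sup>2)
      \<le> ennreal (real (card I) * (LINT y|M. LINT x|M. k x y))"
    unfolding FP by (rule ennreal_leI)
  then show ?thesis
    unfolding k_def[symmetric] nn emeasure_eq_measure
    by (simp add: ennreal_power ennreal_mult' ennreal_of_nat_eq_real_of_nat)
qed

section \<open>The bounds\<close>

theorem proposition3p5:
  fixes scale :: "'k::real_or_complex \<Rightarrow> 'v::ab_group_add \<Rightarrow> 'v"
    and ip :: "'v \<Rightarrow> 'v \<Rightarrow> 'k"
    and d :: nat
    and M :: "'w measure"
    and \<tau> :: "'w \<Rightarrow> 'v"
  assumes "hilbert_space scale ip"
    and "\<exists>B. finite_dimensional_vector_space scale B"
    and "d = vector_space.dim scale (UNIV :: 'v set)"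
    and "continuous_Bessel_family ip M \<tau>"
    and "normalized_family ip M \<tau>"
  shows "(emeasure M (space M))\<^sup>2 / of_nat d \<le> frame_potential ip M \<tau> \<and>
         frame_potential ip M \<tau> \<le> (emeasure M (space M))\<^sup>2 \<and>
         (diagonal M \<in> sets (M \<Otimes>\<^sub>M M) \<longrightarrow>
           emeasure (M \<Otimes>\<^sub>M M) (diagonal M) \<le> frame_potential ip M \<tau> \<and>
           frame_potential ip M \<tau> \<le> (emeasure M (space M))\<^sup>2)"
proof -
  interpret hilbert_space scale ip by fact
  obtain E where E: "finite E" "card E \<le> d" "orthonormal E" "\<And>x. proj E x = x"
    using assms(2,3) exists_orthonormal_basis by metis
  have [measurable]: "(\<lambda>\<alpha>. ip h (\<tau> \<alpha>)) \<in> borel_measurable M" for h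
    using assms(4) by (simp add: continuous_Bessel_family_def)
  obtain b where b: "(\<integral>\<^sup>+\<alpha>. ennreal ((norm (ip h (\<tau> \<alpha>)))\<^sup>2) \<partial>M) \<le> ennreal (b * (ip_norm ip h)\<^sup>2)" for h
    using assms(4) unfolding continuous_Bessel_family_def by blast
  have unit: "ip_norm ip (\<tau> \<alpha>) = 1" if "\<alpha> \<in> space M" for \<alpha>
    using assms(5) that by (simp add: normalized_family_def)
  have sum1: "(\<Sum>e\<in>E. (norm (ip (\<tau> \<alpha>) e))\<^sup>2) = 1" if "\<alpha> \<in> space M" for \<alpha>
    using parseval[OF E(1,3,4)] unit[OF that] by simp

  \<comment> \<open>The Bessel bound, summed over the basis, forces the measure to be finite.\<close>
  have "emeasure M (space M) = (\<integral>\<^sup>+\<alpha>. (\<Sum>e\<in>E. ennreal ((norm (ip e (\<tau> \<alpha>)))\<^sup>2)) \<partial>M)"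
  proof -
    have "(\<integral>\<^sup>+\<alpha>. (\<Sum>e\<in>E. ennreal ((norm (ip e (\<tau> \<alpha>)))\<^sup>2)) \<partial>M) = (\<integral>\<^sup>+\<alpha>. 1 \<partial>M)"
      using sum1 by (intro nn_integral_cong) (simp add: sum_ennreal norm_ip_commute[of _ "\<tau> _"])
    then show ?thesis by simp
  qed
  also have "\<dots> = (\<Sum>e\<in>E. \<integral>\<^sup>+\<alpha>. ennreal ((norm (ip e (\<tau> \<alpha>)))\<^sup>2) \<partial>M)"
    by (rule nn_integral_sum) measurable
  also have "\<dots> < \<infinity>"
    using E(1) le_less_trans[OF b] by (simp add: ennreal_sum_less_top less_top)
  finally interpret finite_measure M
    by (intro finite_measureI) simp

  have fp: "frame_potential ip M \<tau> =
    (\<integral>\<^sup>+\<beta>. (\<integral>\<^sup>+\<alpha>. ennreal ((norm (\<Sum>e\<in>E. to_complex (ip (\<tau> \<alpha>) e) * cnj (to_complex (ip (\<tau> \<beta>) e))))\<^sup>2) \<partial>M) \<partial>M)"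
    unfolding frame_potential_def ip_expansion[OF E(4), symmetric] norm_to_complex ..
  have "(emeasure M (space M))\<^sup>2 \<le> of_nat (card E) * frame_potential ip M \<tau>"
    unfolding fp
  proof (rule frame_potential_coordinates_ge[OF E(1)])
    fix e
    have "(\<lambda>\<alpha>. cnj (to_complex (ip e (\<tau> \<alpha>)))) \<in> borel_measurable M"
      by measurable
    then show "(\<lambda>\<alpha>. to_complex (ip (\<tau> \<alpha>) e)) \<in> borel_measurable M"
      by (simp only: ip_conj_sym[symmetric])
  qed (simp add: norm_to_complex sum1)
  also have "\<dots> \<le> of_nat d * frame_potential ip M \<tau>"
    using E(2) by (intro mult_right_mono) auto
  finally have le: "(emeasure M (space M))\<^sup>2 \<le> of_nat d * frame_potential ip M \<tau>" .
  have lower: "(emeasure M (space M))\<^sup>2 / of_nat d \<le> frame_potential ip M \<tau>"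
  proof (cases "d = 0")
    case True
    \<comment> \<open>There are no unit vectors, the measure is zero, and \<open>0 / 0 = 0\<close>.\<close>
    with le show ?thesis by simp
  next
    case False
    then have "of_nat d * frame_potential ip M \<tau> / of_nat d = frame_potential ip M \<tau>"
      by (subst mult.commute) (simp add: mult_divide_eq_ennreal)
    with divide_right_mono_ennreal[OF le, of "of_nat d"] show ?thesis by simp
  qed

  have "frame_potential ip M \<tau> \<le> (\<integral>\<^sup>+\<beta>. (\<integral>\<^sup>+\<alpha>. 1 \<partial>M) \<partial>M)"
    unfolding frame_potential_def
    by (intro nn_integral_mono) (simp add: norm_ip_le_1 unit)
  then have upper: "frame_potential ip M \<tau> \<le> (emeasure M (space M))\<^sup>2"
    by (simp add: power2_eq_square)

  have "emeasure (M \<Otimes>\<^sub>M M) (diagonal M) \<le> frame_potential ip M \<tau>"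
    if "diagonal M \<in> sets (M \<Otimes>\<^sub>M M)"
    unfolding emeasure_pair_measure[OF that] frame_potential_def
  proof (intro nn_integral_mono)
    fix \<beta> \<alpha> assume "\<beta> \<in> space M" "\<alpha> \<in> space M"
    then show "indicator (diagonal M) (\<beta>, \<alpha>) \<le> ennreal ((norm (ip (\<tau> \<alpha>) (\<tau> \<beta>)))\<^sup>2)"
      by (auto simp: indicator_def diagonal_def ip_self_of_unit unit)
  qed
  with lower upper show ?thesis by blast
qed

end
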